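(* Let $x$ and $y$ be representations of a countable set $A$ such that $x(A)$ and $y(A)$ are both computationally enumerable. Then either $x$ and $y$ are transformationally equivalent, or they are incomparable, i.e., neither $\mathrm{comp}(x)\subseteq\mathrm{comp}(y)$ nor $\mathrm{comp}(y)\subseteq\mathrm{comp}(x)$.
   Context: $\mathbb{T}$ denotes the set of tapes over a fixed finite alphabet with finitely many non-blank symbols. For $Q\subseteq\mathbb{T}$, a function with domain $Q$ and values in $\mathbb{T}$ is computable if some Turing machine, on every input $\tau\in Q$, halts with output equal to the function's value (nothing is required outside $Q$). A set $Q\subseteq\mathbb{T}$ is computationally enumerable if there is a computable $h$ with domain $Q$ and values in $Q$ and $\tau_0\in Q$ such that each element of $Q$ is $h^i(\tau_0)$ for some $i$. A representation of $A$ is an injective function $A\to\mathbb{T}$. Representations $x,y$ are transformationally equivalent if $y\circ x^{-1}$ (on $x(A)$) and $x\circ y^{-1}$ (on $y(A)$) are both computable. $\mathrm{comp}(x)$ is the set of functions $g$ with domain $A$ and values in $A$ such that $x\circ g\circ x^{-1}$ is computable on $x(A)$. Standing assumptions: a fixed tape pairing bijection with computable duplication, swap, projections and partial application, and a Turing machine deciding equality of the components of a pair. *)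

theory Defs
  imports Complex_Main "HOL-Library.FuncSet" "HOL-Library.Countable_Set"
begin

text \<open>
  The alphabet is \<^typ>\<open>'c option\<close> for a finite type \<^typ>\<open>'c\<close> of non-blank symbols, with
  \<^term>\<open>None\<close> as the blank. A tape is recorded as seen from the head: cell 0 is the
  scanned cell, and moving the head shifts the tape.
\<close>

type_synonym 'c tape = "int \<Rightarrow> 'c option"

definition tapes :: "'c tape set" where
  "tapes = {\<tau>. finite {i. \<tau> i \<noteq> None}}"

datatype direction = Left | Stay | Right

fun move :: "direction \<Rightarrow> 'c tape \<Rightarrow> 'c tape" where
  "move Left \<tau> = (\<lambda>i. \<tau> (i - 1))"
| "move Stay \<tau> = \<tau>"
| "move Right \<tau> = (\<lambda>i. \<tau> (i + 1))"

text \<open>A machine halts when \<open>trans\<close> yields \<^term>\<open>None\<close>.\<close>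

record 'c tm =
  states :: "nat set"
  start :: nat
  trans :: "nat \<Rightarrow> 'c option \<Rightarrow> (nat \<times> 'c option \<times> direction) option"

definition turing_machine :: "'c tm \<Rightarrow> bool" where
  "turing_machine M \<longleftrightarrow>
     finite (states M) \<and> start M \<in> states M \<and>
     (\<forall>q\<in>states M. \<forall>s q' s' d. trans M q s = Some (q', s', d) \<longrightarrow> q' \<in> states M)"

inductive step :: "'c tm \<Rightarrow> nat \<times> 'c tape \<Rightarrow> nat \<times> 'c tape \<Rightarrow> bool" for M where
  "trans M q (\<tau> 0) = Some (q', s, d) \<Longrightarrow> step M (q, \<tau>) (q', move d (\<tau>(0 := s)))"

definition halts_with :: "'c tm \<Rightarrow> 'c tape \<Rightarrow> nat \<Rightarrow> 'c tape \<Rightarrow> bool" where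
  "halts_with M \<tau> q \<tau>' \<longleftrightarrow>
     (step M)\<^sup>*\<^sup>* (start M, \<tau>) (q, \<tau>') \<and> trans M q (\<tau>' 0) = None"

definition outputs :: "'c tm \<Rightarrow> 'c tape \<Rightarrow> 'c tape \<Rightarrow> bool" where
  "outputs M \<tau> \<tau>' \<longleftrightarrow> (\<exists>q. halts_with M \<tau> q \<tau>')"

definition computable_on :: "'c tape set \<Rightarrow> ('c tape \<Rightarrow> 'c tape) \<Rightarrow> bool" where
  "computable_on Q f \<longleftrightarrow> (\<exists>M. turing_machine M \<and> (\<forall>\<tau>\<in>Q. outputs M \<tau> (f \<tau>)))"

definition computationally_enumerable :: "'c tape set \<Rightarrow> bool" where
  "computationally_enumerable Q \<longleftrightarrow>
     (\<exists>h \<in> Q \<rightarrow> Q. computable_on Q h \<and> (\<exists>\<tau>\<^sub>0\<in>Q. \<forall>\<tau>\<in>Q. \<exists>i. (h ^^ i) \<tau>\<^sub>0 = \<tau>))"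

text \<open>
  The standing assumptions on a set \<open>T\<close> of tapes. Taking \<open>T = tapes\<close> is the case of all tapes
  with finitely many non-blank symbols, but \<open>T\<close> is left open on purpose: a machine cannot find
  out how far the content of an arbitrary tape in \<^const>\<open>tapes\<close> extends, so it computes no
  constant function on \<^const>\<open>tapes\<close>, whereas \<open>partial_fix\<close> and \<open>proj1\<close> together provide all
  constants on \<open>T\<close>. The usual input convention is an instance: the tapes whose non-blank symbols form one
  contiguous block that starts at the head.

  Partial application comes in both forms: fixing one component, and running a machine on one
  component. The latter keeps the halting state, so that it also applies to machines that give
  their answer by the state they halt in, such as the one in \<open>equality\<close>.
\<close>

locale tape_pairing =
  fixes T :: "'c::finite tape set" and pair :: "'c tape \<Rightarrow> 'c tape \<Rightarrow> 'c tape"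
  assumes subset_tapes: "T \<subseteq> tapes"
    and bij: "bij_betw (\<lambda>(\<sigma>, \<tau>). pair \<sigma> \<tau>) (T \<times> T) T"
    and dup: "\<exists>M. turing_machine M \<and> (\<forall>\<tau>\<in>T. outputs M \<tau> (pair \<tau> \<tau>))"
    and swap: "\<exists>M. turing_machine M \<and> (\<forall>\<sigma>\<in>T. \<forall>\<tau>\<in>T. outputs M (pair \<sigma> \<tau>) (pair \<tau> \<sigma>))"
    and proj1: "\<exists>M. turing_machine M \<and> (\<forall>\<sigma>\<in>T. \<forall>\<tau>\<in>T. outputs M (pair \<sigma> \<tau>) \<sigma>)"
    and proj2: "\<exists>M. turing_machine M \<and> (\<forall>\<sigma>\<in>T. \<forall>\<tau>\<in>T. outputs M (pair \<sigma> \<tau>) \<tau>)"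
    and partial_fix:
      "\<forall>\<sigma>\<in>T. \<exists>M. turing_machine M \<and> (\<forall>\<tau>\<in>T. outputs M \<tau> (pair \<sigma> \<tau>))"
    and partial_run:
      "\<forall>M. turing_machine M \<longrightarrow>
         (\<exists>M'. turing_machine M' \<and>
           (\<forall>\<sigma>\<in>T. \<forall>\<sigma>'\<in>T. \<forall>\<tau>\<in>T. \<forall>q. halts_with M \<sigma> q \<sigma>' \<longrightarrow>
              halts_with M' (pair \<sigma> \<tau>) q (pair \<sigma>' \<tau>)))"
    and equality:
      "\<exists>M accept. turing_machine M \<and>
         (\<forall>\<sigma>\<in>T. \<forall>\<tau>\<in>T. \<exists>q. \<exists>\<rho>\<in>T. halts_with M (pair \<sigma> \<tau>) q \<rho> \<and> (q \<in> accept \<longleftrightarrow> \<sigma> = \<tau>))"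

definition tape_representation :: "'c tape set \<Rightarrow> 'a set \<Rightarrow> ('a \<Rightarrow> 'c tape) \<Rightarrow> bool" where
  "tape_representation T A x \<longleftrightarrow> x \<in> A \<rightarrow> T \<and> inj_on x A"

definition transformationally_equivalent ::
    "'a set \<Rightarrow> ('a \<Rightarrow> 'c tape) \<Rightarrow> ('a \<Rightarrow> 'c tape) \<Rightarrow> bool" where
  "transformationally_equivalent A x y \<longleftrightarrow>
     computable_on (x ` A) (y \<circ> the_inv_into A x) \<and>
     computable_on (y ` A) (x \<circ> the_inv_into A y)"

definition comp_set :: "'a set \<Rightarrow> ('a \<Rightarrow> 'c tape) \<Rightarrow> ('a \<Rightarrow> 'a) set" where
  "comp_set A x = {g \<in> A \<rightarrow>\<^sub>E A. computable_on (x ` A) (x \<circ> g \<circ> the_inv_into A x)}"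

definition incomparable :: "'a set \<Rightarrow> ('a \<Rightarrow> 'c tape) \<Rightarrow> ('a \<Rightarrow> 'c tape) \<Rightarrow> bool" where
  "incomparable A x y \<longleftrightarrow>
     \<not> comp_set A x \<subseteq> comp_set A y \<and> \<not> comp_set A y \<subseteq> comp_set A x"

end

theory Submission
  imports Defs
begin

text \<open>
  Suppose \<open>comp(x) \<subseteq> comp(y)\<close>. Pulling the enumerator of \<open>x(A)\<close> back along \<open>x\<close> gives a map
  \<open>g \<in> comp(x)\<close> whose orbit of some \<open>a\<^sub>0\<close> is all of \<open>A\<close>. As \<open>g \<in> comp(y)\<close> too, one machine can
  step through the pairs \<open>(x(g\<^sup>i a\<^sub>0), y(g\<^sup>i a\<^sub>0))\<close>. Searching for an input in one component and
  returning the other computes both translations, so \<open>x\<close> and \<open>y\<close> are equivalent.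
\<close>

section \<open>Branching and iteration of machines\<close>

text \<open>The states of the three machines are kept apart by their residues modulo 3.\<close>

definition branch :: "'c tm \<Rightarrow> nat set \<Rightarrow> 'c tm \<Rightarrow> 'c tm \<Rightarrow> 'c tm" where
  "branch M acc N N' =
    \<lparr>states = (\<lambda>q. 3 * q) ` states M \<union> (\<lambda>q. 3 * q + 1) ` states N \<union> (\<lambda>q. 3 * q + 2) ` states N',
     start = 3 * start M,
     trans = (\<lambda>q s.
       if q mod 3 = 0 then
         (case trans M (q div 3) s of
            Some (q', s', d) \<Rightarrow> Some (3 * q', s', d)
          | None \<Rightarrow>
              Some (if q div 3 \<in> acc then 3 * start N + 1 else 3 * start N' + 2, s, Stay))
       else if q mod 3 = 1 then
         map_option (\<lambda>(q', s', d). (3 * q' + 1, s', d)) (trans N (q div 3) s)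
       else
         map_option (\<lambda>(q', s', d). (3 * q' + 2, s', d)) (trans N' (q div 3) s))\<rparr>"

text \<open>A do-until loop: one run of \<open>M\<close> is one round, and only the tape passes from
  a round to the next. The exit test reads the halting state, since deciding machines answer by that
  state.\<close>

definition repeat_until :: "nat set \<Rightarrow> 'c tm \<Rightarrow> 'c tm" where
  "repeat_until acc M =
    \<lparr>states = states M, start = start M,
     trans = (\<lambda>q s. case trans M q s of
         Some r \<Rightarrow> Some r
       | None \<Rightarrow> if q \<in> acc then None else Some (start M, s, Stay))\<rparr>"

lemma mod_div_3 [simp]:
  "Suc (3 * q) mod 3 = 1" "Suc (Suc (3 * q)) mod 3 = 2"
  "Suc (3 * q) div 3 = q" "Suc (Suc (3 * q)) div 3 = q"
  by presburger+

lemma branch_simps: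
  "start (branch M acc N N') = 3 * start M"
  "trans (branch M acc N N') (3 * q) s =
     (case trans M q s of
        Some (q', s', d) \<Rightarrow> Some (3 * q', s', d)
      | None \<Rightarrow> Some (if q \<in> acc then 3 * start N + 1 else 3 * start N' + 2, s, Stay))"
  "trans (branch M acc N N') (3 * q + 1) s =
     map_option (\<lambda>(q', s', d). (3 * q' + 1, s', d)) (trans N q s)"
  "trans (branch M acc N N') (3 * q + 2) s =
     map_option (\<lambda>(q', s', d). (3 * q' + 2, s', d)) (trans N' q s)"
  by (simp_all add: branch_def)

lemma states_branch:
  "3 * q \<in> states (branch M acc N N') \<longleftrightarrow> q \<in> states M"
  "3 * q + 1 \<in> states (branch M acc N N') \<longleftrightarrow> q \<in> states N"
  "3 * q + 2 \<in> states (branch M acc N N') \<longleftrightarrow> q \<in> states N'"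
  unfolding branch_def by (auto simp: image_iff; presburger)+

lemma turing_machine_branch:
  assumes "turing_machine M" "turing_machine N" "turing_machine N'"
  shows "turing_machine (branch M acc N N')"
  unfolding turing_machine_def
proof (intro conjI ballI allI impI)
  show "finite (states (branch M acc N N'))" "start (branch M acc N N') \<in> states (branch M acc N N')"
    using assms by (auto simp: branch_def turing_machine_def)
next
  fix q s q' s' d
  assume q: "q \<in> states (branch M acc N N')" and t: "trans (branch M acc N N') q s = Some (q', s', d)"
  from q consider p where "q = 3 * p" "p \<in> states M" | p where "q = 3 * p + 1" "p \<in> states N"
    | p where "q = 3 * p + 2" "p \<in> states N'"
    by (auto simp: branch_def)
  then show "q' \<in> states (branch M acc N N')"
  proof cases
    case 1
    show ?thesis
    proof (cases "trans M p s")
      case None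
      with t have "q' = (if p \<in> acc then 3 * start N + 1 else 3 * start N' + 2)"
        unfolding 1 branch_simps by simp
      with assms show ?thesis
        by (simp only: states_branch turing_machine_def split: if_split) simp
    next
      case (Some r)
      with t obtain p' where "q' = 3 * p'" "trans M p s = Some (p', s', d)"
        unfolding 1 branch_simps by (auto split: prod.splits)
      moreover from this assms 1 have "p' \<in> states M"
        unfolding turing_machine_def by metis
      ultimately show ?thesis
        by (simp only: states_branch)
    qed
  next
    case 2
    with t obtain p' where p': "q' = 3 * p' + 1" "trans N p s = Some (p', s', d)"
      unfolding 2 branch_simps by auto
    with assms 2 have "p' \<in> states N"
      unfolding turing_machine_def by metis
    with p' show ?thesis
      by (simp only: states_branch)
  next
    case 3
    with t obtain p' where p': "q' = 3 * p' + 2" "trans N' p s = Some (p', s', d)"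
      unfolding 3 branch_simps by auto
    with assms 3 have "p' \<in> states N'"
      unfolding turing_machine_def by metis
    with p' show ?thesis
      by (simp only: states_branch)
  qed
qed

lemma turing_machine_repeat_until:
  "turing_machine M \<Longrightarrow> turing_machine (repeat_until acc M)"
  by (auto simp: repeat_until_def turing_machine_def split: option.splits if_splits)

text \<open>A step depends on the state and the scanned symbol alone, so renaming states leaves the
  evolution of the tape untouched. Only the defined transitions have to carry over, which leaves
  \<open>N\<close> free to go on where \<open>M\<close> halts; \<open>branch\<close> and
  \<open>repeat_until\<close> both rely on this.\<close>

lemma rtranclp_step_map_states:
  assumes "(step M)\<^sup>*\<^sup>* c c'"
    and "\<And>q s q' s' d. trans M q s = Some (q', s', d) \<Longrightarrow> trans N (f q) s = Some (f q', s', d)"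
  shows "(step N)\<^sup>*\<^sup>* (map_prod f id c) (map_prod f id c')"
  using assms(1)
proof induction
  case (step c' c'')
  from step.hyps(2) have "step N (map_prod f id c') (map_prod f id c'')"
    by cases (auto intro!: step.intros assms(2))
  with step.IH show ?case
    by (rule rtranclp.rtrancl_into_rtrancl)
qed simp

lemma step_Stay:
  assumes "trans M q (\<tau> 0) = Some (q', \<tau> 0, Stay)"
  shows "step M (q, \<tau>) (q', \<tau>)"
  using step.intros[of M q \<tau> q' "\<tau> 0" Stay] assms by simp

text \<open>\<open>M\<close> is replayed in the states divisible by 3. Where it halts, one extra
  \<open>Stay\<close> step enters the start state of the chosen machine, which finds the tape
  exactly as \<open>M\<close> left it.\<close>

lemma halts_with_branch_first:
  assumes "halts_with M \<tau> q \<tau>'"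
  shows "(step (branch M acc N N'))\<^sup>*\<^sup>* (start (branch M acc N N'), \<tau>)
    (if q \<in> acc then 3 * start N + 1 else 3 * start N' + 2, \<tau>')"
proof -
  from assms have "(step M)\<^sup>*\<^sup>* (start M, \<tau>) (q, \<tau>')" and halt: "trans M q (\<tau>' 0) = None"
    by (auto simp: halts_with_def)
  then have "(step (branch M acc N N'))\<^sup>*\<^sup>* (3 * start M, \<tau>) (3 * q, \<tau>')"
    using rtranclp_step_map_states[of M "(start M, \<tau>)" "(q, \<tau>')" "branch M acc N N'" "\<lambda>q. 3 * q"]
    by (simp add: branch_simps)
  moreover have "step (branch M acc N N') (3 * q, \<tau>')
      (if q \<in> acc then 3 * start N + 1 else 3 * start N' + 2, \<tau>')"
    by (rule step_Stay) (simp only: branch_simps halt option.case)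
  ultimately show ?thesis
    by (simp add: branch_simps)
qed

text \<open>The run of \<open>N\<close> is replayed under its tag. The halting state is recorded
  along with the output tape because nested branches later read from it which way the computation
  went.\<close>

lemma halts_with_branch_accept:
  assumes "halts_with M \<tau> q \<tau>'" "q \<in> acc" "halts_with N \<tau>' q' \<tau>''"
  shows "halts_with (branch M acc N N') \<tau> (3 * q' + 1) \<tau>''"
proof -
  from assms(3) have "(step N)\<^sup>*\<^sup>* (start N, \<tau>') (q', \<tau>'')" "trans N q' (\<tau>'' 0) = None"
    by (auto simp: halts_with_def)
  then have "(step (branch M acc N N'))\<^sup>*\<^sup>* (3 * start N + 1, \<tau>') (3 * q' + 1, \<tau>'')"
    "trans (branch M acc N N') (3 * q' + 1) (\<tau>'' 0) = None"
    using rtranclp_step_map_states[of N "(start N, \<tau>')" "(q', \<tau>'')" "branch M acc N N'"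
        "\<lambda>q. 3 * q + 1"]
    unfolding branch_simps by (simp_all add: branch_simps[simplified])
  with halts_with_branch_first[OF assms(1), of acc N N'] assms(2) show ?thesis
    unfolding halts_with_def by (auto intro: rtranclp_trans)
qed

lemma halts_with_branch_reject:
  assumes "halts_with M \<tau> q \<tau>'" "q \<notin> acc" "halts_with N' \<tau>' q' \<tau>''"
  shows "halts_with (branch M acc N N') \<tau> (3 * q' + 2) \<tau>''"
proof -
  from assms(3) have "(step N')\<^sup>*\<^sup>* (start N', \<tau>') (q', \<tau>'')" "trans N' q' (\<tau>'' 0) = None"
    by (auto simp: halts_with_def)
  then have "(step (branch M acc N N'))\<^sup>*\<^sup>* (3 * start N' + 2, \<tau>') (3 * q' + 2, \<tau>'')"
    "trans (branch M acc N N') (3 * q' + 2) (\<tau>'' 0) = None"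
    using rtranclp_step_map_states[of N' "(start N', \<tau>')" "(q', \<tau>'')" "branch M acc N N'"
        "\<lambda>q. 3 * q + 2"]
    unfolding branch_simps by (simp_all add: branch_simps[simplified])
  with halts_with_branch_first[OF assms(1), of acc N N'] assms(2) show ?thesis
    unfolding halts_with_def by (auto intro: rtranclp_trans)
qed

lemma rtranclp_step_repeat_until:
  assumes "(step M)\<^sup>*\<^sup>* c c'"
  shows "(step (repeat_until acc M))\<^sup>*\<^sup>* c c'"
  using rtranclp_step_map_states[OF assms, of "repeat_until acc M" id]
  by (simp add: repeat_until_def prod.map_id)

lemma outputs_repeat_until_accept:
  assumes "halts_with M \<tau> q \<tau>'" "q \<in> acc"
  shows "outputs (repeat_until acc M) \<tau> \<tau>'"
proof -
  have "(step (repeat_until acc M))\<^sup>*\<^sup>* (start M, \<tau>) (q, \<tau>')"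
    using assms(1) by (intro rtranclp_step_repeat_until) (simp add: halts_with_def)
  moreover have "trans (repeat_until acc M) q (\<tau>' 0) = None"
    using assms by (simp add: halts_with_def repeat_until_def)
  moreover have "start (repeat_until acc M) = start M"
    by (simp add: repeat_until_def)
  ultimately show ?thesis
    unfolding outputs_def halts_with_def by auto
qed

text \<open>Unrolling a single round: the rejecting run, the \<open>Stay\<close> step back to the
  start state, and then the rest of the loop. This is the form needed for an induction on the number
  of rounds.\<close>

lemma outputs_repeat_until_reject:
  assumes "halts_with M \<tau> q \<tau>'" "q \<notin> acc" "outputs (repeat_until acc M) \<tau>' \<tau>''"
  shows "outputs (repeat_until acc M) \<tau> \<tau>''"
proof -
  have "(step (repeat_until acc M))\<^sup>*\<^sup>* (start M, \<tau>) (q, \<tau>')"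
    using assms(1) by (intro rtranclp_step_repeat_until) (simp add: halts_with_def)
  also have "step (repeat_until acc M) (q, \<tau>') (start M, \<tau>')"
    using assms by (intro step_Stay) (simp add: halts_with_def repeat_until_def)
  finally have "(step (repeat_until acc M))\<^sup>*\<^sup>* (start M, \<tau>) (start M, \<tau>')" .
  moreover have "start (repeat_until acc M) = start M"
    by (simp add: repeat_until_def)
  ultimately show ?thesis
    using assms(3) unfolding outputs_def halts_with_def
    by (auto intro: rtranclp_trans)
qed

section \<open>Computability of indexed families of tapes\<close>

text \<open>The index is a parameter that the machine never sees, but one machine must serve all
  indices. Composite tapes such as nested pairs can thus be described by their ingredients, without
  inverting the pairing, and shrinking the index set shrinks the domain.\<close>

definition transforms :: "'i set \<Rightarrow> ('i \<Rightarrow> 'c tape) \<Rightarrow> ('i \<Rightarrow> 'c tape) \<Rightarrow> bool" where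
  "transforms I F G \<longleftrightarrow> (\<exists>M. turing_machine M \<and> (\<forall>i\<in>I. outputs M (F i) (G i)))"

text \<open>The tape left behind must lie in \<open>T\<close>, so that \<open>partial_run\<close> applies to the decider.\<close>

definition decides :: "'c tape set \<Rightarrow> 'i set \<Rightarrow> ('i \<Rightarrow> 'c tape) \<Rightarrow> ('i \<Rightarrow> bool) \<Rightarrow> bool" where
  "decides T I F P \<longleftrightarrow>
     (\<exists>M acc. turing_machine M \<and>
       (\<forall>i\<in>I. \<exists>q. \<exists>\<rho>\<in>T. halts_with M (F i) q \<rho> \<and> (q \<in> acc \<longleftrightarrow> P i)))"

lemma transforms_trans:
  assumes "transforms I F G" "transforms I G H"
  shows "transforms I F H"
proof -
  obtain M where "turing_machine M" "\<forall>i\<in>I. outputs M (F i) (G i)"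
    using assms(1) by (auto simp: transforms_def)
  moreover obtain N where "turing_machine N" "\<forall>i\<in>I. outputs N (G i) (H i)"
    using assms(2) by (auto simp: transforms_def)
  \<comment> \<open>With \<open>UNIV\<close> as accepting set, every halting state of
    \<open>M\<close> leads on to the first \<open>N\<close>, so \<open>branch\<close> becomes
    sequential composition.\<close>
  ultimately have "turing_machine (branch M UNIV N N)"
    "\<forall>i\<in>I. outputs (branch M UNIV N N) (F i) (H i)"
    unfolding outputs_def by (blast intro: turing_machine_branch halts_with_branch_accept)+
  then show ?thesis
    by (auto simp: transforms_def)
qed

lemma transforms_decides:
  assumes "transforms I F G" "decides T I G P"
  shows "decides T I F P"
proof -
  obtain M where M: "turing_machine M" "\<And>i. i \<in> I \<Longrightarrow> outputs M (F i) (G i)"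
    using assms(1) by (auto simp: transforms_def)
  obtain N acc where N: "turing_machine N"
    "\<And>i. i \<in> I \<Longrightarrow> \<exists>q. \<exists>\<rho>\<in>T. halts_with N (G i) q \<rho> \<and> (q \<in> acc \<longleftrightarrow> P i)"
    using assms(2) unfolding decides_def by metis
  \<comment> \<open>The accepting states of \<open>N\<close> reappear under the tag that
    \<open>N\<close> carries in the combined machine.\<close>
  have "\<exists>q. \<exists>\<rho>\<in>T. halts_with (branch M UNIV N N) (F i) q \<rho> \<and> (q \<in> (\<lambda>q. 3 * q + 1) ` acc \<longleftrightarrow> P i)"
    if i: "i \<in> I" for i
  proof -
    obtain p where p: "halts_with M (F i) p (G i)"
      using M(2)[OF i] by (auto simp: outputs_def)
    obtain q \<rho> where q: "\<rho> \<in> T" "halts_with N (G i) q \<rho>" "q \<in> acc \<longleftrightarrow> P i"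
      using N(2)[OF i] by blast
    have "halts_with (branch M UNIV N N) (F i) (3 * q + 1) \<rho>"
      by (rule halts_with_branch_accept[OF p _ q(2)]) simp
    moreover have "3 * q + 1 \<in> (\<lambda>q. 3 * q + 1) ` acc \<longleftrightarrow> P i"
      using q(3) by auto
    ultimately show ?thesis
      using q(1) by blast
  qed
  with turing_machine_branch[OF M(1) N(1) N(1)] show ?thesis
    unfolding decides_def by blast
qed

lemma transforms_reindex:
  assumes "transforms J F G" "\<phi> \<in> I \<rightarrow> J"
  shows "transforms I (\<lambda>i. F (\<phi> i)) (\<lambda>i. G (\<phi> i))"
  using assms unfolding transforms_def by (meson PiE)

section \<open>Operations on paired tapes and unbounded search\<close>

context tape_pairing
begin

lemma pair_in [intro, simp]: "\<sigma> \<in> T \<Longrightarrow> \<tau> \<in> T \<Longrightarrow> pair \<sigma> \<tau> \<in> T"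
  using bij_betwE[OF bij] by auto

lemma transforms_pair_first:
  assumes "transforms I F G" and "F \<in> I \<rightarrow> T" "G \<in> I \<rightarrow> T" "H \<in> I \<rightarrow> T"
  shows "transforms I (\<lambda>i. pair (F i) (H i)) (\<lambda>i. pair (G i) (H i))"
proof -
  obtain M where M: "turing_machine M" "\<And>i. i \<in> I \<Longrightarrow> outputs M (F i) (G i)"
    using assms(1) by (auto simp: transforms_def)
  obtain M' where "turing_machine M'"
    "\<And>\<sigma> \<sigma>' \<tau> q. \<sigma> \<in> T \<Longrightarrow> \<sigma>' \<in> T \<Longrightarrow> \<tau> \<in> T \<Longrightarrow> halts_with M \<sigma> q \<sigma>' \<Longrightarrow>
       halts_with M' (pair \<sigma> \<tau>) q (pair \<sigma>' \<tau>)"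
    using partial_run M(1) by meson
  with M(2) assms(2-) show ?thesis
    unfolding transforms_def outputs_def by (meson PiE)
qed

lemma transforms_swap:
  assumes "F \<in> I \<rightarrow> T" "G \<in> I \<rightarrow> T"
  shows "transforms I (\<lambda>i. pair (F i) (G i)) (\<lambda>i. pair (G i) (F i))"
  using swap assms unfolding transforms_def by (meson PiE)

lemma transforms_proj1:
  assumes "F \<in> I \<rightarrow> T" "G \<in> I \<rightarrow> T"
  shows "transforms I (\<lambda>i. pair (F i) (G i)) F"
  using proj1 assms unfolding transforms_def by (meson PiE)

lemma transforms_proj2:
  assumes "F \<in> I \<rightarrow> T" "G \<in> I \<rightarrow> T"
  shows "transforms I (\<lambda>i. pair (F i) (G i)) G"
  using proj2 assms unfolding transforms_def by (meson PiE)

lemma decides_equality: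
  assumes "F \<in> I \<rightarrow> T" "G \<in> I \<rightarrow> T"
  shows "decides T I (\<lambda>i. pair (F i) (G i)) (\<lambda>i. F i = G i)"
proof -
  obtain M acc where "turing_machine M"
    "\<And>\<sigma> \<tau>. \<sigma> \<in> T \<Longrightarrow> \<tau> \<in> T \<Longrightarrow>
       \<exists>q. \<exists>\<rho>\<in>T. halts_with M (pair \<sigma> \<tau>) q \<rho> \<and> (q \<in> acc \<longleftrightarrow> \<sigma> = \<tau>)"
    using equality by metis
  with assms show ?thesis
    unfolding decides_def by (intro exI[of _ M] exI[of _ acc]) (simp add: Pi_iff)
qed

text \<open>A loop with test \<open>P\<close>, whose body acts on the index by \<open>f\<close>.
  Since \<open>R\<close> does not change along the iteration, the answer given at the stopping index
  is the one wanted at the initial index, and \<open>ex\<close> guarantees termination.\<close>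

lemma transforms_iterate:
  assumes P: "decides T I S P" and S: "S \<in> I \<rightarrow> T" and f: "f \<in> {i \<in> I. \<not> P i} \<rightarrow> I"
    and out: "transforms {i \<in> I. P i} S R"
    and body: "transforms {i \<in> I. \<not> P i} S (\<lambda>i. S (f i))"
    and inv: "\<And>i. i \<in> I \<Longrightarrow> \<not> P i \<Longrightarrow> R (f i) = R i"
    and ex: "\<And>i. i \<in> I \<Longrightarrow> \<exists>n. P ((f ^^ n) i)"
  shows "transforms I S R"
proof -
  obtain D acc where D: "turing_machine D"
    "\<And>i. i \<in> I \<Longrightarrow> \<exists>q. \<exists>\<rho>\<in>T. halts_with D (S i) q \<rho> \<and> (q \<in> acc \<longleftrightarrow> P i)"
    using P unfolding decides_def by metis
  obtain D' where D': "turing_machine D'"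
    "\<And>\<sigma> \<sigma>' \<tau> q. \<sigma> \<in> T \<Longrightarrow> \<sigma>' \<in> T \<Longrightarrow> \<tau> \<in> T \<Longrightarrow> halts_with D \<sigma> q \<sigma>' \<Longrightarrow>
       halts_with D' (pair \<sigma> \<tau>) q (pair \<sigma>' \<tau>)"
    using partial_run D(1) by meson
  obtain C where C: "turing_machine C" "\<And>\<tau>. \<tau> \<in> T \<Longrightarrow> outputs C \<tau> (pair \<tau> \<tau>)"
    using dup by blast
  \<comment> \<open>The decider destroys its input, so it runs on a copy.\<close>
  obtain N where N: "turing_machine N"
    "\<And>i \<rho>. i \<in> I \<Longrightarrow> P i \<Longrightarrow> \<rho> \<in> T \<Longrightarrow> outputs N (pair \<rho> (S i)) (R i)"
  proof -
    \<comment> \<open>The first index component ranges over the tapes that the decider may leave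
      behind. Projecting it away recovers the saved copy of \<open>S i\<close>.\<close>
    let ?J = "T \<times> {i \<in> I. P i}"
    have "transforms ?J (\<lambda>j. pair (fst j) (S (snd j))) (\<lambda>j. R (snd j))"
      using S by (intro transforms_trans[OF transforms_proj2 transforms_reindex[OF out]]) auto
    then show ?thesis
      using that by (fastforce simp: transforms_def)
  qed
  obtain N' where N': "turing_machine N'"
    "\<And>i \<rho>. i \<in> I \<Longrightarrow> \<not> P i \<Longrightarrow> \<rho> \<in> T \<Longrightarrow> outputs N' (pair \<rho> (S i)) (S (f i))"
  proof -
    let ?J = "T \<times> {i \<in> I. \<not> P i}"
    have "transforms ?J (\<lambda>j. pair (fst j) (S (snd j))) (\<lambda>j. S (f (snd j)))"
      using S by (intro transforms_trans[OF transforms_proj2 transforms_reindex[OF body]]) auto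
    then show ?thesis
      using that by (fastforce simp: transforms_def)
  qed
  \<comment> \<open>One round of the loop: duplicate the tape, test the first copy, then either
    produce the result or advance, working from the second copy.\<close>
  define B where "B = branch C UNIV (branch D' acc N N') C"
  \<comment> \<open>A halting state \<open>r\<close> of \<open>N\<close> is tagged twice, by the
    inner and by the outer branch. Rounds that end in \<open>N'\<close> halt in
    \<open>3 * (3 * r + 2) + 1\<close>, so the inner residue tells exit from continuation.\<close>
  define stop where "stop = range (\<lambda>q::nat. 3 * (3 * q + 1) + 1)"
  have B: "turing_machine B"
    unfolding B_def by (intro turing_machine_branch C D' N N')
  have test: "\<exists>p q \<rho>. halts_with C (S i) p (pair (S i) (S i)) \<and> \<rho> \<in> T \<and>
      halts_with D' (pair (S i) (S i)) q (pair \<rho> (S i)) \<and> (q \<in> acc \<longleftrightarrow> P i)" if "i \<in> I" for i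
  proof -
    have "S i \<in> T"
      using S that by auto
    then show ?thesis
      using C(2)[of "S i"] D(2)[OF that] D'(2) unfolding outputs_def by metis
  qed
  have accept: "outputs (repeat_until stop B) (S i) (R i)" if i: "i \<in> I" and "P i" for i
  proof -
    obtain p q \<rho> where *: "halts_with C (S i) p (pair (S i) (S i))" "\<rho> \<in> T"
      "halts_with D' (pair (S i) (S i)) q (pair \<rho> (S i))" "q \<in> acc"
      using test[OF i] \<open>P i\<close> by blast
    obtain r where "halts_with N (pair \<rho> (S i)) r (R i)"
      using N(2)[OF i \<open>P i\<close> *(2)] by (auto simp: outputs_def)
    from halts_with_branch_accept[OF *(1) UNIV_I halts_with_branch_accept[OF *(3,4) this]]
    have "halts_with B (S i) (3 * (3 * r + 1) + 1) (R i)"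
      unfolding B_def .
    then show ?thesis
      by (rule outputs_repeat_until_accept) (simp add: stop_def)
  qed
  have reject: "\<exists>q. q \<notin> stop \<and> halts_with B (S i) q (S (f i))" if i: "i \<in> I" and "\<not> P i" for i
  proof -
    obtain p q \<rho> where *: "halts_with C (S i) p (pair (S i) (S i))" "\<rho> \<in> T"
      "halts_with D' (pair (S i) (S i)) q (pair \<rho> (S i))" "q \<notin> acc"
      using test[OF i] \<open>\<not> P i\<close> by blast
    obtain r where "halts_with N' (pair \<rho> (S i)) r (S (f i))"
      using N'(2)[OF i \<open>\<not> P i\<close> *(2)] by (auto simp: outputs_def)
    from halts_with_branch_accept[OF *(1) UNIV_I halts_with_branch_reject[OF *(3,4) this]]
    have "halts_with B (S i) (3 * (3 * r + 2) + 1) (S (f i))"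
      unfolding B_def .
    moreover have "3 * (3 * r + 2) + 1 \<notin> stop"
      unfolding stop_def by (auto; presburger)
    ultimately show ?thesis
      by blast
  qed
  \<comment> \<open>Here \<open>n\<close> need not be the first time at which \<open>P\<close>
    holds. If \<open>P i\<close> holds already, the loop exits at once; otherwise the induction
    hypothesis applies to \<open>f i\<close>, and \<open>inv\<close> turns its result into that of
    \<open>i\<close>.\<close>
  have "outputs (repeat_until stop B) (S i) (R i)" if "i \<in> I" "P ((f ^^ n) i)" for i n
    using that
  proof (induction n arbitrary: i)
    case 0
    then show ?case
      using accept by simp
  next
    case (Suc n)
    show ?case
    proof (cases "P i")
      case True
      then show ?thesis
        using accept Suc.prems(1) by blast
    next
      case False
      have "f i \<in> I"
        using f Suc.prems(1) False by auto
      moreover have "P ((f ^^ n) (f i))"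
        using Suc.prems(2) by (simp add: funpow_swap1)
      ultimately have "outputs (repeat_until stop B) (S (f i)) (R i)"
        using Suc.IH[of "f i"] inv[OF Suc.prems(1) False] by simp
      then show ?thesis
        using reject[OF Suc.prems(1) False] outputs_repeat_until_reject by blast
    qed
  qed
  with ex turing_machine_repeat_until[OF B] show ?thesis
    unfolding transforms_def by blast
qed

section \<open>Translating between representations\<close>

lemma transforms_comp_set:
  assumes "tape_representation T A x" "g \<in> comp_set A x"
  shows "transforms A x (\<lambda>a. x (g a))"
  using assms
  by (auto simp: comp_set_def computable_on_def transforms_def tape_representation_def
      the_inv_into_f_f)

text \<open>The conditions on \<open>g\<close> are symmetric in \<open>x\<close> and
  \<open>y\<close>, and the orbit condition speaks of \<open>A\<close> and not of tapes. Exchanging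
  \<open>x\<close> and \<open>y\<close> therefore gives the inverse translation from the same
  \<open>g\<close>.\<close>

lemma computable_on_translation:
  assumes x: "tape_representation T A x" and y: "tape_representation T A y"
    and gx: "g \<in> comp_set A x" and gy: "g \<in> comp_set A y"
    and a0: "a\<^sub>0 \<in> A" and orbit: "\<And>a. a \<in> A \<Longrightarrow> \<exists>n. (g ^^ n) a\<^sub>0 = a"
  shows "computable_on (x ` A) (y \<circ> the_inv_into A x)"
proof -
  have xT: "x \<in> A \<rightarrow> T" and yT: "y \<in> A \<rightarrow> T" and inj: "inj_on x A"
    using x y by (auto simp: tape_representation_def)
  have gA: "g \<in> A \<rightarrow> A"
    using gx by (auto simp: comp_set_def)
  \<comment> \<open>In an index \<open>(a, b)\<close>, \<open>a\<close> is the current point of the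
    orbit and \<open>b\<close> the element searched for. The tape \<open>S\<close> holds both
    representations of \<open>a\<close> next to the input \<open>x b\<close>; advancing by
    \<open>f\<close> moves \<open>a\<close> along \<open>g\<close> and keeps
    \<open>b\<close>.\<close>
  define u where "u = (\<lambda>(a, b::'a). x a)"
  define v where "v = (\<lambda>(a, b::'a). y a)"
  define w where "w = (\<lambda>(a::'a, b). x b)"
  define S where "S = (\<lambda>i. pair (pair (u i) (v i)) (w i))"
  define f where "f = (\<lambda>(a, b::'a). (g a, b))"
  let ?I = "A \<times> A"
  have uvw: "u \<in> ?I \<rightarrow> T" "v \<in> ?I \<rightarrow> T" "w \<in> ?I \<rightarrow> T" "(\<lambda>i. pair (u i) (v i)) \<in> ?I \<rightarrow> T"
    using xT yT by (auto simp: u_def v_def w_def Pi_iff)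
  have f: "f \<in> ?I \<rightarrow> ?I"
    using gA by (auto simp: f_def)
  have uf: "(\<lambda>i. u (f i)) \<in> ?I \<rightarrow> T" and vf: "(\<lambda>i. v (f i)) \<in> ?I \<rightarrow> T"
    using uvw f unfolding Pi_iff by blast+
  have "transforms ?I (\<lambda>i. x (fst i)) (\<lambda>i. x (g (fst i)))"
    by (rule transforms_reindex[OF transforms_comp_set[OF x gx]]) auto
  then have tu: "transforms ?I u (\<lambda>i. u (f i))"
    by (simp add: u_def f_def case_prod_beta')
  have "transforms ?I (\<lambda>i. y (fst i)) (\<lambda>i. y (g (fst i)))"
    by (rule transforms_reindex[OF transforms_comp_set[OF y gy]]) auto
  then have tv: "transforms ?I v (\<lambda>i. v (f i))"
    by (simp add: v_def f_def case_prod_beta')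
  have wf: "w (f i) = w i" for i
    by (simp add: w_def f_def case_prod_beta')
  \<comment> \<open>A machine can be run on the first component of a pair only, so the second
    component is advanced between two swaps.\<close>
  have "transforms ?I (\<lambda>i. pair (u i) (v i)) (\<lambda>i. pair (u (f i)) (v i))"
    by (intro transforms_pair_first tu uvw uf)
  also have "transforms ?I \<dots> (\<lambda>i. pair (v i) (u (f i)))"
    by (intro transforms_swap uvw uf)
  finally (transforms_trans) have "transforms ?I (\<lambda>i. pair (u i) (v i)) (\<lambda>i. pair (v i) (u (f i)))" .
  also have "transforms ?I (\<lambda>i. pair (v i) (u (f i))) (\<lambda>i. pair (v (f i)) (u (f i)))"
    by (intro transforms_pair_first tv uvw uf vf)
  finally (transforms_trans) have "transforms ?I (\<lambda>i. pair (u i) (v i)) (\<lambda>i. pair (v (f i)) (u (f i)))" .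
  also have "transforms ?I (\<lambda>i. pair (v (f i)) (u (f i))) (\<lambda>i. pair (u (f i)) (v (f i)))"
    by (intro transforms_swap uf vf)
  finally (transforms_trans)
  have uv: "transforms ?I (\<lambda>i. pair (u i) (v i)) (\<lambda>i. pair (u (f i)) (v (f i)))" .
  have uvf: "(\<lambda>i. pair (u (f i)) (v (f i))) \<in> ?I \<rightarrow> T"
    using uf vf by (auto simp: Pi_iff)
  have Sf: "transforms ?I S (\<lambda>i. S (f i))"
    unfolding S_def wf by (intro transforms_pair_first uv uvw uvf)
  have S_uv: "transforms ?I S (\<lambda>i. pair (u i) (v i))"
    unfolding S_def by (intro transforms_proj1 uvw)
  have ST: "S \<in> ?I \<rightarrow> T"
    using uvw by (auto simp: S_def Pi_iff)
  let ?P = "\<lambda>(a, b). a = b"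
  \<comment> \<open>The search need not terminate from a pair outside this set, since \<open>g\<close> may never return to \<open>b\<close>.\<close>
  define K where "K = {(a, b) \<in> ?I. \<exists>n. (g ^^ n) a = b}"
  have K: "K \<subseteq> ?I"
    by (auto simp: K_def)
  \<comment> \<open>Dropping \<open>y a\<close> brings \<open>x a\<close> and \<open>x b\<close>
    together for the equality machine. As \<open>x\<close> is injective on \<open>A\<close>, equal
    tapes mean \<open>a = b\<close>.\<close>
  have "decides T K S (\<lambda>i. u i = w i)"
  proof (rule transforms_decides)
    show "transforms K S (\<lambda>i. pair (u i) (w i))"
      unfolding S_def using uvw K
      by (intro transforms_pair_first transforms_proj1) auto
    show "decides T K (\<lambda>i. pair (u i) (w i)) (\<lambda>i. u i = w i)"
      using uvw K by (intro decides_equality) auto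
  qed
  moreover have "u i = w i \<longleftrightarrow> ?P i" if "i \<in> K" for i
    using that K inj by (auto simp: u_def w_def inj_on_eq_iff)
  ultimately have dec: "decides T K S ?P"
    by (simp add: decides_def)
  have fn: "(f ^^ n) (a, b) = ((g ^^ n) a, b)" for n a b
    by (induction n) (auto simp: f_def)
  have "transforms K S (\<lambda>i. y (snd i))"
  proof (rule transforms_iterate[OF dec])
    show "S \<in> K \<rightarrow> T"
      using ST K by auto
    show "f \<in> {i \<in> K. \<not> ?P i} \<rightarrow> K"
    proof clarify
      fix a b
      assume "(a, b) \<in> K" and "a \<noteq> b"
      \<comment> \<open>Since \<open>a\<close> differs from \<open>b\<close>, \<open>n\<close> is
        positive, so \<open>b\<close> can still be reached from \<open>g a\<close> in one step
        less.\<close>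
      then obtain n where ab: "a \<in> A" "b \<in> A" "(g ^^ n) a = b"
        by (auto simp: K_def)
      with \<open>a \<noteq> b\<close> obtain m where "n = Suc m"
        by (cases n) auto
      with ab have "(g ^^ m) (g a) = b"
        by (simp add: funpow_swap1)
      with ab gA show "f (a, b) \<in> K"
        by (auto simp: f_def K_def)
    qed
    \<comment> \<open>At these indices \<open>a = b\<close>, so the tape \<open>y a\<close> carried
      along is the desired \<open>y b\<close>.\<close>
    have "transforms {i \<in> K. ?P i} S v"
      using transforms_reindex[OF transforms_trans[OF S_uv transforms_proj2[OF uvw(1,2)]],
          of "\<lambda>i. i" "{i \<in> K. ?P i}"] K by auto
    then show "transforms {i \<in> K. ?P i} S (\<lambda>i. y (snd i))"
      by (auto simp: transforms_def v_def)
    show "transforms {i \<in> K. \<not> ?P i} S (\<lambda>i. S (f i))"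
      using transforms_reindex[OF Sf, of "\<lambda>i. i" "{i \<in> K. \<not> ?P i}"] K by auto
    show "y (snd (f i)) = y (snd i)" for i
      by (simp add: f_def case_prod_beta')
    show "\<exists>n. ?P ((f ^^ n) i)" if "i \<in> K" for i
      using that by (auto simp: K_def fn)
  qed
  \<comment> \<open>Every search starts at \<open>a\<^sub>0\<close>, whose orbit meets each element
    of \<open>A\<close>.\<close>
  moreover have "(\<lambda>b. (a\<^sub>0, b)) \<in> A \<rightarrow> K"
    using a0 orbit by (auto simp: K_def)
  ultimately have "transforms A (\<lambda>b. S (a\<^sub>0, b)) y"
    using transforms_reindex[of K S "\<lambda>i. y (snd i)" "\<lambda>b. (a\<^sub>0, b)" A] by simp
  moreover have "transforms A x (\<lambda>b. S (a\<^sub>0, b))"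
  proof -
    \<comment> \<open>The starting pair is a fixed tape, so \<open>partial_fix\<close> builds it
      into the machine that prepares the search from the input \<open>x b\<close>.\<close>
    have "pair (x a\<^sub>0) (y a\<^sub>0) \<in> T"
      using xT yT a0 by auto
    then obtain M where "turing_machine M"
      "\<And>\<tau>. \<tau> \<in> T \<Longrightarrow> outputs M \<tau> (pair (pair (x a\<^sub>0) (y a\<^sub>0)) \<tau>)"
      using partial_fix by meson
    with xT show ?thesis
      unfolding transforms_def by (auto simp: S_def u_def v_def w_def)
  qed
  ultimately have "transforms A x y"
    using transforms_trans by blast
  then show ?thesis
    using inj by (auto simp: transforms_def computable_on_def the_inv_into_f_f)
qed

lemma transformationally_equivalent_if_comp_set_subset:
  assumes x: "tape_representation T A x" and y: "tape_representation T A y"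
    and enum: "computationally_enumerable (x ` A)" and sub: "comp_set A x \<subseteq> comp_set A y"
  shows "transformationally_equivalent A x y"
proof -
  have inj: "inj_on x A"
    using x by (simp add: tape_representation_def)
  obtain h \<tau>\<^sub>0 where h: "h \<in> x ` A \<rightarrow> x ` A" "computable_on (x ` A) h" and "\<tau>\<^sub>0 \<in> x ` A"
    and hit: "\<And>\<tau>. \<tau> \<in> x ` A \<Longrightarrow> \<exists>i. (h ^^ i) \<tau>\<^sub>0 = \<tau>"
    using enum unfolding computationally_enumerable_def by blast
  then obtain a\<^sub>0 where a0: "a\<^sub>0 \<in> A" "\<tau>\<^sub>0 = x a\<^sub>0"
    by auto
  \<comment> \<open>This is the enumerator \<open>h\<close> transported to \<open>A\<close>; it is
    restricted because members of \<open>comp_set\<close> are extensional functions.\<close>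
  define g where "g = restrict (\<lambda>a. the_inv_into A x (h (x a))) A"
  have gA: "g a \<in> A" and xg: "x (g a) = h (x a)" if "a \<in> A" for a
  proof -
    have "h (x a) \<in> x ` A"
      using h(1) that by auto
    then show "g a \<in> A" "x (g a) = h (x a)"
      using that inj by (auto simp: g_def the_inv_into_f_f)
  qed
  have "g \<in> A \<rightarrow>\<^sub>E A"
    using gA by (auto simp: g_def)
  then have gx: "g \<in> comp_set A x"
    using h(2) xg inj by (auto simp: comp_set_def computable_on_def the_inv_into_f_f)
  then have gy: "g \<in> comp_set A y"
    using sub by auto
  \<comment> \<open>Membership in \<open>A\<close> belongs to the induction because
    \<open>gA\<close> and \<open>xg\<close> are available only for elements of \<open>A\<close>.
    Injectivity of \<open>x\<close> then turns hitting \<open>x a\<close> by \<open>h\<close> into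
    hitting \<open>a\<close> by \<open>g\<close>.\<close>
  have iter: "(g ^^ n) a\<^sub>0 \<in> A \<and> x ((g ^^ n) a\<^sub>0) = (h ^^ n) \<tau>\<^sub>0" for n
    by (induction n) (use a0 gA xg in auto)
  have orbit: "\<exists>n. (g ^^ n) a\<^sub>0 = a" if "a \<in> A" for a
    using hit[of "x a"] iter that inj by (metis imageI inj_onD)
  show ?thesis
    unfolding transformationally_equivalent_def
    using computable_on_translation[OF x y gx gy a0(1) orbit]
      computable_on_translation[OF y x gy gx a0(1) orbit] by blast
qed

end

theorem theorem11:
  fixes T :: "'c::finite tape set" and pair :: "'c tape \<Rightarrow> 'c tape \<Rightarrow> 'c tape"
    and A :: "'a set" and x y :: "'a \<Rightarrow> 'c tape"
  assumes "tape_pairing T pair"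
    and "countable A"
    and "tape_representation T A x" and "tape_representation T A y"
    and "computationally_enumerable (x ` A)" and "computationally_enumerable (y ` A)"
  shows "transformationally_equivalent A x y \<or> incomparable A x y"
proof -
  interpret tape_pairing T pair
    by fact
  \<comment> \<open>If incomparability fails, one of the two inclusions holds. The reverse inclusion
    gives equivalence of \<open>y\<close> and \<open>x\<close>, which is the same conjunction with
    its parts exchanged.\<close>
  show ?thesis
    using transformationally_equivalent_if_comp_set_subset[of A x y]
      transformationally_equivalent_if_comp_set_subset[of A y x] assms
    by (auto simp: incomparable_def transformationally_equivalent_def)
qed

end
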